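(* Let $\mathsf{J},\mathsf{K}$ be kernels on $S$ such that $\mathsf{J}\prec\mathsf{K}$. The following statements are equivalent. (i) $\mathsf{J}$ and $\mathsf{K}-\mathsf{J}$ are singular. (ii) $\mathbf{D}_{\mathsf{J}}\mathsf{K}=\mathsf{J}$. (iii) $\mathsf{J}$ is an extreme point of the convex set $[\mathsf{0},\mathsf{K}]=\{\mathsf{U}\text{ a kernel on }S\mid\mathsf{0}\prec\mathsf{U}\prec\mathsf{K}\}$.
   Context: Let $S$ be a non-empty set and $\mathfrak{E}$ a complex Banach space with topological dual $\mathfrak{E}^{*}$. The dual pairing $\langle\cdot,\cdot\rangle:\mathfrak{E}\times\mathfrak{E}^{*}\to\mathbb{C}$ is taken linear in the first and conjugate linear in the second variable (the vector space structure of $\mathfrak{E}^*$ is chosen accordingly). $\mathbf{B}(\mathfrak{E},\mathfrak{E}^{*})$ is the space of bounded linear operators from $\mathfrak{E}$ to $\mathfrak{E}^*$. $\mathfrak{X}$ is the complex linear space of finitely supported functions $f:S\to\mathfrak{E}$. A kernel on $S$ is a function $\mathsf{K}:S\times S\to\mathbf{B}(\mathfrak{E},\mathfrak{E}^{*})$ with $\sum_{s,t\in S}\langle f(t),\mathsf{K}(s,t)f(s)\rangle\ge0$ for all $f\in\mathfrak{X}$. Linear operations on kernels are pointwise; $\mathsf{0}$ is the zero kernel. A form on $\mathfrak{X}$ is a map $\mathfrak{t}:\mathfrak{X}\times\mathfrak{X}\to\mathbb{C}$, linear in the first and antilinear in the second argument, with $\mathfrak{t}[x]:=\mathfrak{t}(x,x)\ge0$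 for all $x$. Write $\mathfrak{t}\le\mathfrak{w}$ if $\mathfrak{t}[x]\le\mathfrak{w}[x]$ for all $x$. Forms $\mathfrak{t},\mathfrak{w}$ are singular if the only form $\mathfrak{s}$ with $\mathfrak{s}\le\mathfrak{t}$ and $\mathfrak{s}\le\mathfrak{w}$ is $\mathfrak{s}=0$. The parallel sum of forms is the form given by $(\mathfrak{t}:\mathfrak{w})[x]=\inf_{y\in\mathfrak{X}}\{\mathfrak{t}[x-y]+\mathfrak{w}[y]\}$, and $\mathbf{D}_{\mathfrak{w}}\mathfrak{t}:=\sup_{n\in\mathbb{N}}(\mathfrak{t}:n\mathfrak{w})$ (pointwise supremum of quadratic forms), which is a form with $\mathbf{D}_{\mathfrak{w}}\mathfrak{t}\le\mathfrak{t}$. The form associated with a kernel $\mathsf{K}$ is $\mathfrak{w}_{\mathsf{K}}(f,g)=\sum_{s,t\in S}\langle f(t),\mathsf{K}(s,t)g(s)\rangle$; write $\mathsf{K}\prec\mathsf{L}$ if $\mathfrak{w}_{\mathsf{K}}\le\mathfrak{w}_{\mathsf{L}}$. Every form $\mathfrak{w}\le\mathfrak{w}_{\mathsf{K}}$ is the associated form of a unique kernel; $\mathbf{D}_{\mathsf{L}}\mathsf{K}$ denotes the unique kernel whose associated form is $\mathbf{D}_{\mathfrak{w}_{\mathsf{L}}}\mathfrak{w}_{\mathsf{K}}$. Two kernels are singular if their associated forms are singular. *)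

theory Defs
  imports
    "HOL-Analysis.Analysis"
    "HOL-Library.Function_Algebras"
    "HOL-Analysis.Finite_Function_Topology"
begin

section \<open>Complex vector spaces and complex Banach spaces\<close>

class complex_vector = real_vector +
  fixes scaleC :: "complex \<Rightarrow> 'a \<Rightarrow> 'a"  (infixr \<open>*\<^sub>C\<close> 75)
  assumes scaleC_add_right: "c *\<^sub>C (x + y) = c *\<^sub>C x + c *\<^sub>C y"
    and scaleC_add_left: "(b + c) *\<^sub>C x = b *\<^sub>C x + c *\<^sub>C x"
    and scaleC_scaleC: "b *\<^sub>C (c *\<^sub>C x) = (b * c) *\<^sub>C x"
    and scaleC_one: "1 *\<^sub>C x = x"
    and scaleC_of_real: "complex_of_real r *\<^sub>C x = r *\<^sub>R x"

class complex_normed_vector = complex_vector + real_normed_vector +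
  assumes norm_scaleC: "norm (c *\<^sub>C x) = cmod c * norm x"

class complex_banach = complex_normed_vector + banach

instantiation complex :: complex_normed_vector
begin
definition scaleC_complex_def: "c *\<^sub>C (z::complex) = c * z"
instance
  by standard (simp_all add: scaleC_complex_def algebra_simps norm_mult scaleR_conv_of_real)
end

definition clinear :: "('a::complex_vector \<Rightarrow> 'b::complex_vector) \<Rightarrow> bool" where
  "clinear f \<longleftrightarrow> (\<forall>x y. f (x + y) = f x + f y) \<and> (\<forall>c x. f (c *\<^sub>C x) = c *\<^sub>C f x)"

definition antilinear :: "('a::complex_vector \<Rightarrow> 'b::complex_vector) \<Rightarrow> bool" where
  "antilinear f \<longleftrightarrow> (\<forall>x y. f (x + y) = f x + f y) \<and> (\<forall>c x. f (c *\<^sub>C x) = cnj c *\<^sub>C f x)"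

lemma scaleC_zero_right [simp]: "c *\<^sub>C (0::'a::complex_vector) = 0"
  using scaleC_add_right[of c "0::'a" 0] by simp


section \<open>The topological dual\<close>

text \<open>
  Elements of the dual are the complex linear bounded functionals, with the operator norm.
  The scalar multiplication is conjugated, so that the pairing is conjugate linear in the
  functional.
\<close>

typedef (overloaded) 'a cdual =
    "{\<phi> :: 'a::complex_normed_vector \<Rightarrow>\<^sub>L complex. clinear (blinfun_apply \<phi>)}"
  by (rule exI[of _ 0]) (simp add: clinear_def)

setup_lifting type_definition_cdual

instantiation cdual :: (complex_normed_vector) complex_normed_vector
begin

lift_definition zero_cdual :: "'a cdual" is 0
  by (simp add: clinear_def)
lift_definition plus_cdual :: "'a cdual \<Rightarrow> 'a cdual \<Rightarrow> 'a cdual" is "(+)"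
  by (simp add: clinear_def blinfun.add_left scaleC_complex_def algebra_simps)
lift_definition minus_cdual :: "'a cdual \<Rightarrow> 'a cdual \<Rightarrow> 'a cdual" is "(-)"
  by (simp add: clinear_def blinfun.diff_left scaleC_complex_def algebra_simps)
lift_definition uminus_cdual :: "'a cdual \<Rightarrow> 'a cdual" is uminus
  by (simp add: clinear_def blinfun.minus_left scaleC_complex_def algebra_simps)
lift_definition scaleR_cdual :: "real \<Rightarrow> 'a cdual \<Rightarrow> 'a cdual" is scaleR
  by (simp add: clinear_def blinfun.scaleR_left scaleC_complex_def algebra_simps)
lift_definition scaleC_cdual :: "complex \<Rightarrow> 'a cdual \<Rightarrow> 'a cdual"
  is "\<lambda>c \<phi>. blinfun_mult_right (cnj c) o\<^sub>L \<phi>"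
  by (simp add: clinear_def scaleC_complex_def algebra_simps)
lift_definition norm_cdual :: "'a cdual \<Rightarrow> real" is norm .

definition dist_cdual :: "'a cdual \<Rightarrow> 'a cdual \<Rightarrow> real" where
  "dist_cdual \<phi> \<psi> = norm (\<phi> - \<psi>)"
definition sgn_cdual :: "'a cdual \<Rightarrow> 'a cdual" where
  "sgn_cdual \<phi> = scaleR (inverse (norm \<phi>)) \<phi>"
definition uniformity_cdual :: "('a cdual \<times> 'a cdual) filter" where
  "uniformity_cdual = (INF e\<in>{0<..}. principal {(\<phi>, \<psi>). dist \<phi> \<psi> < e})"
definition open_cdual :: "'a cdual set \<Rightarrow> bool" where
  "open_cdual U \<longleftrightarrow> (\<forall>\<phi>\<in>U. \<forall>\<^sub>F (\<phi>', \<psi>) in uniformity. \<phi>' = \<phi> \<longrightarrow> \<psi> \<in> U)"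

instance
proof
  fix c :: complex and \<phi> :: "'a cdual"
  show "norm (c *\<^sub>C \<phi>) = cmod c * norm \<phi>"
  proof (transfer)
    fix c :: complex and \<phi> :: "'a \<Rightarrow>\<^sub>L complex"
    show "norm (blinfun_mult_right (cnj c) o\<^sub>L \<phi>) = cmod c * norm \<phi>"
    proof (cases "c = 0")
      case True
      then have "blinfun_mult_right (cnj c) o\<^sub>L \<phi> = 0"
        by (intro blinfun_eqI) simp
      then show ?thesis using True by simp
    next
      case False
      show ?thesis
      proof (rule antisym)
        show "norm (blinfun_mult_right (cnj c) o\<^sub>L \<phi>) \<le> cmod c * norm \<phi>"
          by (rule norm_blinfun_bound)
             (simp_all add: norm_mult mult.assoc mult_left_mono norm_blinfun)
        have "norm \<phi> \<le> norm (blinfun_mult_right (cnj c) o\<^sub>L \<phi>) / cmod c"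
        proof (rule norm_blinfun_bound)
          fix x
          have "cmod c * cmod (blinfun_apply \<phi> x)
              \<le> norm (blinfun_mult_right (cnj c) o\<^sub>L \<phi>) * norm x"
            using norm_blinfun[of "blinfun_mult_right (cnj c) o\<^sub>L \<phi>" x]
            by (simp add: norm_mult)
          then show "cmod (blinfun_apply \<phi> x)
              \<le> norm (blinfun_mult_right (cnj c) o\<^sub>L \<phi>) / cmod c * norm x"
            using False by (simp add: field_simps)
        qed simp
        then show "cmod c * norm \<phi> \<le> norm (blinfun_mult_right (cnj c) o\<^sub>L \<phi>)"
          using False by (simp add: field_simps)
      qed
    qed
  qed
qed (unfold dist_cdual_def sgn_cdual_def uniformity_cdual_def open_cdual_def,
     (transfer, auto intro!: blinfun_eqI
        simp: blinfun.bilinear_simps algebra_simps scaleR_conv_of_real norm_triangle_ineq)+)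

end

lift_definition cpairing :: "'a::complex_normed_vector \<Rightarrow> 'a cdual \<Rightarrow> complex"
  is "\<lambda>x \<phi>. blinfun_apply \<phi> x" .

lemma clinear_cpairing: "clinear (\<lambda>x. cpairing x \<phi>)"
  by transfer

lemma antilinear_cpairing: "antilinear (cpairing x)"
  unfolding antilinear_def by transfer (simp add: blinfun.add_left scaleC_complex_def)


section \<open>Forms\<close>

instantiation poly_mapping :: (type, complex_vector) complex_vector
begin
lift_definition scaleC_poly_mapping :: "complex \<Rightarrow> ('a \<Rightarrow>\<^sub>0 'b) \<Rightarrow> ('a \<Rightarrow>\<^sub>0 'b)"
  is "\<lambda>c f s. c *\<^sub>C f s"
  by (rule finite_subset) auto
instance
proof
  fix r :: real and f :: "'a \<Rightarrow>\<^sub>0 'b"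
  have "finite {s. r *\<^sub>R Poly_Mapping.lookup f s \<noteq> 0}"
    by (rule finite_subset[OF _ finite_keys[of f]]) (auto simp: in_keys_iff)
  then show "complex_of_real r *\<^sub>C f = r *\<^sub>R f"
    by (intro poly_mapping_eqI) (simp add: scaleR_poly_mapping_def scaleC_poly_mapping.rep_eq scaleC_of_real)
qed (transfer, simp add: scaleC_add_right scaleC_add_left scaleC_scaleC scaleC_one)+
end

type_synonym 'x form = "'x \<Rightarrow> 'x \<Rightarrow> complex"

definition is_form :: "'x::complex_vector form \<Rightarrow> bool" where
  "is_form t \<longleftrightarrow> (\<forall>y. clinear (\<lambda>x. t x y)) \<and> (\<forall>x. antilinear (t x)) \<and> (\<forall>x. t x x \<in> \<real>\<^sub>\<ge>\<^sub>0)"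

definition quad :: "'x form \<Rightarrow> 'x \<Rightarrow> real" where
  "quad t x = Re (t x x)"

definition form_le :: "'x form \<Rightarrow> 'x form \<Rightarrow> bool" where
  "form_le t w \<longleftrightarrow> (\<forall>x. quad t x \<le> quad w x)"

definition form_singular :: "'x::complex_vector form \<Rightarrow> 'x form \<Rightarrow> bool" where
  "form_singular t w \<longleftrightarrow>
     (\<forall>s. is_form s \<longrightarrow> form_le s t \<longrightarrow> form_le s w \<longrightarrow> s = (\<lambda>x y. 0))"

text \<open>
  By polarization a form is determined by its quadratic form, so the definite descriptions
  below have at most one candidate.
\<close>

definition parallel_sum :: "'x::complex_vector form \<Rightarrow> 'x form \<Rightarrow> 'x form" where
  "parallel_sum t w =
     (THE p. is_form p \<and> (\<forall>x. quad p x = (INF y. quad t (x - y) + quad w y)))"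

text \<open>\<open>form_D w t\<close> is \<open>D\<^sub>w t = sup\<^sub>n (t : n w)\<close>, the part of \<open>t\<close> relative to \<open>w\<close>.\<close>

definition form_D :: "'x::complex_vector form \<Rightarrow> 'x form \<Rightarrow> 'x form" where
  "form_D w t =
     (THE d. is_form d \<and>
        (\<forall>x. quad d x = (SUP n::nat. quad (parallel_sum t (\<lambda>u v. of_nat n * w u v)) x)))"


section \<open>Kernels\<close>

instantiation "fun" :: (type, real_vector) real_vector
begin
definition scaleR_fun_def: "r *\<^sub>R f = (\<lambda>x. r *\<^sub>R f x)"
instance
  by standard (simp_all add: scaleR_fun_def fun_eq_iff scaleR_add_right scaleR_add_left)
end

type_synonym ('s, 'e) opker = "'s \<Rightarrow> 's \<Rightarrow> ('e \<Rightarrow>\<^sub>L 'e cdual)"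

text \<open>
  The sums range over the supports only; for other \<open>s\<close>, \<open>t\<close> the summand vanishes.
\<close>

definition kernel_form ::
  "('s, 'e::complex_banach) opker \<Rightarrow> ('s \<Rightarrow>\<^sub>0 'e) form" where
  "kernel_form K f g =
     (\<Sum>s\<in>Poly_Mapping.keys g. \<Sum>t\<in>Poly_Mapping.keys f.
        cpairing (Poly_Mapping.lookup f t) (blinfun_apply (K s t) (Poly_Mapping.lookup g s)))"

text \<open>
  \<open>\<Rightarrow>\<^sub>L\<close> only provides real linearity, hence the first conjunct.
\<close>

definition is_kernel :: "('s, 'e::complex_banach) opker \<Rightarrow> bool" where
  "is_kernel K \<longleftrightarrow>
     (\<forall>s t. clinear (blinfun_apply (K s t))) \<and> (\<forall>f. kernel_form K f f \<in> \<real>\<^sub>\<ge>\<^sub>0)"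

definition kernel_le ::
  "('s, 'e::complex_banach) opker \<Rightarrow> ('s, 'e) opker \<Rightarrow> bool"  (infix \<open>\<prec>\<^sub>K\<close> 50) where
  "K \<prec>\<^sub>K L \<longleftrightarrow> form_le (kernel_form K) (kernel_form L)"

definition kernel_singular ::
  "('s, 'e::complex_banach) opker \<Rightarrow> ('s, 'e) opker \<Rightarrow> bool" where
  "kernel_singular K L \<longleftrightarrow> form_singular (kernel_form K) (kernel_form L)"

definition kernel_D ::
  "('s, 'e::complex_banach) opker \<Rightarrow> ('s, 'e) opker \<Rightarrow> ('s, 'e) opker" where
  "kernel_D L K =
     (THE M. is_kernel M \<and> kernel_form M = form_D (kernel_form L) (kernel_form K))"

definition kernel_interval ::
  "('s, 'e::complex_banach) opker \<Rightarrow> ('s, 'e) opker \<Rightarrow> ('s, 'e) opker set" where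
  "kernel_interval L K = {U. is_kernel U \<and> L \<prec>\<^sub>K U \<and> U \<prec>\<^sub>K K}"

lemma cpairing_add_right: "cpairing x (\<phi> + \<psi>) = cpairing x \<phi> + cpairing x \<psi>"
  using antilinear_cpairing[of x] by (simp add: antilinear_def)

lemma cpairing_scaleR_right: "cpairing x (r *\<^sub>R \<phi>) = of_real r * cpairing x \<phi>"
  by transfer (simp add: blinfun.scaleR_left scaleR_conv_of_real)

lemma kernel_form_add: "kernel_form (K + L) f g = kernel_form K f g + kernel_form L f g"
  by (simp add: kernel_form_def blinfun.add_left cpairing_add_right sum.distrib)

lemma kernel_form_scaleR: "kernel_form (r *\<^sub>R K) f g = of_real r * kernel_form K f g"
  by (simp add: kernel_form_def scaleR_fun_def blinfun.scaleR_left cpairing_scaleR_right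
        sum_distrib_left)

lemma convex_kernel_interval: "convex (kernel_interval L K)"
proof (rule convexI)
  fix U V and a b :: real
  assume U: "U \<in> kernel_interval L K" and V: "V \<in> kernel_interval L K"
    and ab: "0 \<le> a" "0 \<le> b" "a + b = 1"
  let ?W = "a *\<^sub>R U + b *\<^sub>R V"
  have q: "quad (kernel_form ?W) f
      = a * quad (kernel_form U) f + b * quad (kernel_form V) f" for f
    by (simp add: quad_def kernel_form_add kernel_form_scaleR)
  have lin: "clinear (blinfun_apply (?W s t))" for s t
    using U V unfolding kernel_interval_def is_kernel_def clinear_def
    by (simp add: scaleR_fun_def blinfun.add_left blinfun.scaleR_left algebra_simps
          scaleC_add_right scaleC_scaleC flip: scaleC_of_real)
  have pos: "kernel_form ?W f f \<in> \<real>\<^sub>\<ge>\<^sub>0" for f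
    using U V ab unfolding kernel_interval_def is_kernel_def
    by (simp add: kernel_form_add kernel_form_scaleR nonneg_Reals_add_I nonneg_Reals_mult_I)
  have "L \<prec>\<^sub>K ?W"
    unfolding kernel_le_def form_le_def
  proof
    fix f
    have "a * quad (kernel_form L) f + b * quad (kernel_form L) f \<le> quad (kernel_form ?W) f"
      unfolding q using U V ab
      by (intro add_mono mult_left_mono) (auto simp: kernel_interval_def kernel_le_def form_le_def)
    then show "quad (kernel_form L) f \<le> quad (kernel_form ?W) f"
      using ab by (simp flip: distrib_right)
  qed
  moreover have "?W \<prec>\<^sub>K K"
    unfolding kernel_le_def form_le_def
  proof
    fix f
    have "quad (kernel_form ?W) f \<le> a * quad (kernel_form K) f + b * quad (kernel_form K) f"
      unfolding q using U V ab
      by (intro add_mono mult_left_mono) (auto simp: kernel_interval_def kernel_le_def form_le_def)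
    then show "quad (kernel_form ?W) f \<le> quad (kernel_form K) f"
      using ab by (simp flip: distrib_right)
  qed
  ultimately show "?W \<in> kernel_interval L K"
    using lin pos by (auto simp: kernel_interval_def is_kernel_def)
qed

end

theory Submission
  imports Defs
begin

text \<open>
  Let \<open>j \<le> k\<close> be the forms of \<open>J\<close> and \<open>K\<close>. A form below \<open>k\<close> that is also below a multiple of \<open>j\<close>
  lies below \<open>D\<^sub>j k\<close>; hence \<open>j \<le> D\<^sub>j k\<close>, and if \<open>D\<^sub>j k = j\<close> then a common minorant \<open>s\<close> of \<open>j\<close> and
  \<open>k - j\<close> satisfies \<open>j + s \<le> j\<close>, while both ends of a segment in \<open>[0, K]\<close> through \<open>J\<close> have forms
  below \<open>j\<close>. Conversely, singularity of \<open>j\<close> and \<open>k - j\<close> forces \<open>D\<^sub>j k \<le> j\<close>, and a common minorant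
  \<open>s\<close> exhibits \<open>J\<close> as the midpoint of the kernels of \<open>j + s\<close> and \<open>j - s\<close>.
\<close>

section \<open>Forms and their quadratic forms\<close>

lemma form_add_left: "is_form t \<Longrightarrow> t (x + y) z = t x z + t y z"
  and form_scaleC_left: "is_form t \<Longrightarrow> t (c *\<^sub>C x) z = c * t x z"
  and form_add_right: "is_form t \<Longrightarrow> t z (x + y) = t z x + t z y"
  and form_scaleC_right: "is_form t \<Longrightarrow> t z (c *\<^sub>C x) = cnj c * t z x"
  by (simp_all add: is_form_def clinear_def antilinear_def scaleC_complex_def)

lemma scaleC_minus_one: "(- 1) *\<^sub>C x = - (x :: 'a::complex_vector)"
  using scaleC_of_real[of "-1" x] by simp

lemma scaleC_minus_left: "(- c) *\<^sub>C x = - (c *\<^sub>C (x :: 'a::complex_vector))"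
  using scaleC_scaleC[of "-1" c x] by (simp add: scaleC_minus_one)

lemma scaleC_minus_right: "c *\<^sub>C (- x) = - (c *\<^sub>C (x :: 'a::complex_vector))"
  using scaleC_scaleC[of c "-1" x] by (simp add: scaleC_minus_left scaleC_one)

lemma scaleC_diff_right: "c *\<^sub>C (x - y) = c *\<^sub>C x - c *\<^sub>C (y :: 'a::complex_vector)"
  using scaleC_add_right[of c x "- y"] by (simp add: scaleC_minus_right)

lemma form_minus_left: "is_form t \<Longrightarrow> t (- x) z = - t x z"
  and form_minus_right: "is_form t \<Longrightarrow> t z (- x) = - t z x"
  using form_scaleC_left[of t "-1" x z] form_scaleC_right[of t z "-1" x]
  by (simp_all add: scaleC_minus_one)

lemma form_diff_left: "is_form t \<Longrightarrow> t (x - y) z = t x z - t y z"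
  and form_diff_right: "is_form t \<Longrightarrow> t z (x - y) = t z x - t z y"
  using form_add_left[of t x "-y" z] form_add_right[of t z x "-y"]
  by (simp_all add: form_minus_left form_minus_right)

lemma form_diag: "is_form t \<Longrightarrow> t x x = of_real (quad t x)"
  by (simp add: is_form_def quad_def complex_nonneg_Reals_iff complex_eq_iff)

lemma quad_nonneg: "is_form t \<Longrightarrow> 0 \<le> quad t x"
  by (simp add: is_form_def quad_def complex_nonneg_Reals_iff)

lemma quad_scaleC:
  assumes "is_form t" shows "quad t (c *\<^sub>C x) = (cmod c)\<^sup>2 * quad t x"
proof -
  have "t (c *\<^sub>C x) (c *\<^sub>C x) = (c * cnj c) * t x x"
    using assms by (simp add: form_scaleC_left form_scaleC_right)
  also have "\<dots> = of_real ((cmod c)\<^sup>2 * quad t x)"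
    using assms by (simp add: form_diag complex_norm_square[symmetric])
  finally show ?thesis by (simp add: quad_def)
qed

lemma quad_scaleR: "is_form t \<Longrightarrow> quad t (r *\<^sub>R x) = r\<^sup>2 * quad t x"
  using quad_scaleC[of t "of_real r" x] by (simp add: scaleC_of_real)

lemma quad_parallelogram:
  "is_form t \<Longrightarrow> quad t (x + y) + quad t (x - y) = 2 * quad t x + 2 * quad t y"
  by (simp add: quad_def form_add_left form_add_right form_diff_left form_diff_right)

text \<open>Reduces questions about a form to its diagonal; both uniqueness and hermitian symmetry
  below are read off from it.\<close>

lemma form_polarization:
  assumes "is_form t"
  shows "4 * t x y = of_real (quad t (x + y)) - of_real (quad t (x - y))
      + \<i> * (of_real (quad t (x + \<i> *\<^sub>C y)) - of_real (quad t (x - \<i> *\<^sub>C y)))"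
  using assms
  by (simp add: form_diag[symmetric] form_add_left form_add_right form_diff_left form_diff_right
      form_scaleC_left form_scaleC_right algebra_simps)

lemma form_eqI:
  assumes "is_form s" "is_form t" "\<And>x. quad s x = quad t x" shows "s = t"
proof (intro ext)
  fix x y
  have "4 * s x y = 4 * t x y"
    unfolding form_polarization[OF assms(1)] form_polarization[OF assms(2)] assms(3) ..
  then show "s x y = t x y" by simp
qed

text \<open>Symmetry is not part of \<open>is_form\<close>; it comes from the diagonal being real.
  As \<open>y + \<i> x = \<i> (x - \<i> y)\<close>, exchanging \<open>x\<close> and \<open>y\<close>
  in the polarization identity swaps the two imaginary terms and keeps the real ones.\<close>

lemma form_hermitian:
  assumes "is_form t" shows "t y x = cnj (t x y)"
proof -
  have q: "quad t (y - x) = quad t (x - y)" "quad t (y + \<i> *\<^sub>C x) = quad t (x - \<i> *\<^sub>C y)"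
    "quad t (y - \<i> *\<^sub>C x) = quad t (x + \<i> *\<^sub>C y)"
    using quad_scaleC[OF assms, of "-1" "x - y"] quad_scaleC[OF assms, of \<i> "x - \<i> *\<^sub>C y"]
      quad_scaleC[OF assms, of "- \<i>" "x + \<i> *\<^sub>C y"]
    by (simp_all add: scaleC_minus_one scaleC_add_right scaleC_diff_right scaleC_scaleC
        scaleC_minus_left scaleC_one add.commute)
  have "4 * t y x = cnj (4 * t x y)"
    unfolding form_polarization[OF assms] using q by (simp add: add.commute algebra_simps)
  then show ?thesis by simp
qed

lemma form_add:
  assumes "is_form s" "is_form t" shows "is_form (\<lambda>x y. s x y + t x y)"
  using assms
  by (auto simp: is_form_def clinear_def antilinear_def scaleC_complex_def algebra_simps
      intro: nonneg_Reals_add_I)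

lemma form_scale:
  assumes "is_form t" "0 \<le> r" shows "is_form (\<lambda>x y. of_real r * t x y)"
  using assms
  by (auto simp: is_form_def clinear_def antilinear_def scaleC_complex_def algebra_simps
      intro!: nonneg_Reals_mult_I)

lemma form_of_nat_scale: "is_form t \<Longrightarrow> is_form (\<lambda>x y. of_nat n * t x y)"
  using form_scale[of t "real n"] by simp

lemma form_diff:
  assumes "is_form s" "is_form t" "form_le s t" shows "is_form (\<lambda>x y. t x y - s x y)"
proof -
  have "t x x - s x x \<in> \<real>\<^sub>\<ge>\<^sub>0" for x
    using assms by (simp add: form_diag form_le_def complex_nonneg_Reals_iff)
  then show ?thesis
    using assms by (auto simp: is_form_def clinear_def antilinear_def scaleC_complex_def algebra_simps)
qed

lemma quad_add [simp]: "quad (\<lambda>x y. s x y + t x y) x = quad s x + quad t x"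
  and quad_diff [simp]: "quad (\<lambda>x y. s x y - t x y) x = quad s x - quad t x"
  and quad_scale [simp]: "quad (\<lambda>x y. of_real r * t x y) x = r * quad t x"
  and quad_of_nat_scale [simp]: "quad (\<lambda>x y. of_nat n * t x y) x = n * quad t x"
  by (simp_all add: quad_def)

text \<open>Rests on the square identity
  \<open>(1 + r) p[x - y] + r (1 + r) p[y] - r p[x] = p[x - (1 + r) y]\<close>.\<close>

lemma quad_split_lower:
  assumes p: "is_form p" and r: "0 \<le> r"
  shows "r / (1 + r) * quad p x \<le> quad p (x - y) + r * quad p y"
proof -
  have "p (x - of_real (1 + r) *\<^sub>C y) (x - of_real (1 + r) *\<^sub>C y)
      = (1 + r) * p (x - y) (x - y) + r * (1 + r) * p y y - r * p x x"
    using p by (simp add: form_diff_left form_diff_right form_scaleC_left form_scaleC_right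
        algebra_simps)
  then have "quad p (x - of_real (1 + r) *\<^sub>C y)
      = (1 + r) * quad p (x - y) + r * (1 + r) * quad p y - r * quad p x"
    by (simp add: quad_def)
  then have "0 \<le> (1 + r) * quad p (x - y) + r * (1 + r) * quad p y - r * quad p x"
    using quad_nonneg[OF p] by metis
  then have "r * quad p x \<le> (quad p (x - y) + r * quad p y) * (1 + r)"
    by (simp add: algebra_simps)
  then show ?thesis using r by (simp add: divide_le_eq)
qed

text \<open>A weighted triangle inequality whose weight on \<open>x\<close> can be brought as close
  to 1 as desired, at the cost of a large weight on \<open>y\<close>. It is
  \<open>quad_split_lower\<close> for \<open>x - y\<close> split into \<open>x\<close> and
  \<open>- y\<close>, with \<open>r = 1 / d\<close>.\<close>

lemma quad_diff_le:
  assumes p: "is_form p" and d: "0 < d"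
  shows "quad p (x - y) \<le> (1 + d) * quad p x + (1 + 1 / d) * quad p y"
proof -
  have "1 / d / (1 + 1 / d) * quad p (x - y) \<le> quad p (x - y - (- y)) + 1 / d * quad p (- y)"
    using quad_split_lower[OF p, of "1 / d" "x - y" "- y"] d by simp
  moreover have "quad p (- y) = quad p y"
    using quad_scaleC[OF p, of "-1" y] by (simp add: scaleC_minus_one)
  moreover have "1 / d / (1 + 1 / d) = 1 / (1 + d)"
    using d by (simp add: field_simps)
  ultimately have "quad p (x - y) / (1 + d) \<le> quad p x + 1 / d * quad p y"
    by simp
  then have "quad p (x - y) \<le> (quad p x + 1 / d * quad p y) * (1 + d)"
    using d by (simp add: divide_le_eq)
  also have "\<dots> = (1 + d) * quad p x + (1 + 1 / d) * quad p y"
    using d by (simp add: field_simps)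
  finally show ?thesis .
qed

lemma cauchy_schwarz_form:
  assumes t: "is_form t"
  shows "(cmod (t x y))\<^sup>2 \<le> quad t x * quad t y"
proof -
  define a where "a = t x y"
  have ineq: "0 \<le> quad t x - 2 * r * (cmod a)\<^sup>2 + r\<^sup>2 * (cmod a)\<^sup>2 * quad t y" for r :: real
  proof -
    \<comment> \<open>A coefficient parallel to \<open>t x y\<close> makes the value at
      \<open>x - ?c y\<close> a real quadratic polynomial in \<open>r\<close>. It is minimized at
      \<open>r = 1 / quad t y\<close>; if \<open>quad t y = 0\<close> it is affine in
      \<open>r\<close>, and a large \<open>r\<close> would make it negative unless
      \<open>a = 0\<close>.\<close>
    let ?c = "of_real r * a"
    have aa: "a * cnj a = of_real ((cmod a)\<^sup>2)" by (rule complex_norm_square[symmetric])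
    have "t (x - ?c *\<^sub>C y) (x - ?c *\<^sub>C y)
        = t x x - cnj ?c * t x y - ?c * t y x + ?c * cnj ?c * t y y"
      using t by (simp add: form_diff_left form_diff_right form_scaleC_left form_scaleC_right
          algebra_simps)
    also have "\<dots> = of_real (quad t x) - 2 * r * (a * cnj a) + r\<^sup>2 * (a * cnj a) * quad t y"
      unfolding form_hermitian[OF t, of y x] a_def[symmetric]
      using t by (simp add: form_diag power2_eq_square algebra_simps)
    also have "\<dots> = of_real (quad t x - 2 * r * (cmod a)\<^sup>2 + r\<^sup>2 * (cmod a)\<^sup>2 * quad t y)"
      unfolding aa by simp
    finally have "quad t (x - ?c *\<^sub>C y) = quad t x - 2 * r * (cmod a)\<^sup>2 + r\<^sup>2 * (cmod a)\<^sup>2 * quad t y"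
      unfolding quad_def by (metis Re_complex_of_real)
    then show ?thesis using quad_nonneg[OF t] by metis
  qed
  show ?thesis
  proof (cases "quad t y = 0")
    case True
    have "(cmod a)\<^sup>2 = 0"
    proof (rule ccontr)
      assume "(cmod a)\<^sup>2 \<noteq> 0"
      then show False
        using ineq[of "(quad t x + 1) / (2 * (cmod a)\<^sup>2)"] True by simp
    qed
    then show ?thesis using True by (simp add: a_def)
  next
    case False
    then have pos: "quad t y > 0" using quad_nonneg[OF t, of y] by simp
    have "0 \<le> quad t x - (cmod a)\<^sup>2 / quad t y"
      using ineq[of "1 / quad t y"] pos by (simp add: power2_eq_square field_simps)
    then show ?thesis using pos by (simp add: a_def field_simps)
  qed
qed

section \<open>Jordan--von Neumann construction\<close>

text \<open>Cauchy's functional equation. Subtracting the linear function with the same value at 1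
  leaves an additive \<open>h\<close> that vanishes on the integers. So \<open>h\<close> has period
  1 and is bounded everywhere, and then \<open>h (n a) = n h a\<close> forces
  \<open>h = 0\<close>.\<close>

lemma additive_bounded_linear:
  fixes g :: "real \<Rightarrow> real"
  assumes add: "\<And>a b. g (a + b) = g a + g b"
    and bd: "\<And>a. \<bar>a\<bar> \<le> 1 \<Longrightarrow> \<bar>g a\<bar> \<le> C"
  shows "g a = a * g 1"
proof -
  define h where "h a = g a - a * g 1" for a
  have hadd: "h (a + b) = h a + h b" for a b
    by (simp add: h_def add algebra_simps)
  have h1: "h 1 = 0" by (simp add: h_def)
  have h0: "h 0 = 0" using hadd[of 0 0] by simp
  have hneg: "h (- a) = - h a" for a using hadd[of a "-a"] h0 by simp
  have hnat: "h (of_nat n * a) = of_nat n * h a" for n a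
    by (induction n) (simp_all add: h0 hadd algebra_simps)
  have hint: "h (of_int k) = 0" for k
    using hnat[of "nat k" 1] hnat[of "nat (- k)" 1] hneg[of "of_int k"]
    by (cases "0 \<le> k") (simp_all add: h1)
  have hbd: "\<bar>h a\<bar> \<le> C + \<bar>g 1\<bar>" for a
  proof -
    have "h a = h (frac a)"
      using hadd[of "frac a" "of_int \<lfloor>a\<rfloor>"] hint by (simp add: frac_def)
    moreover have "\<bar>frac a\<bar> \<le> 1"
      by (simp add: frac_lt_1 less_imp_le)
    moreover have "\<bar>frac a * g 1\<bar> \<le> 1 * \<bar>g 1\<bar>"
      unfolding abs_mult by (intro mult_right_mono) (simp_all add: frac_lt_1 less_imp_le)
    ultimately show ?thesis
      using bd[of "frac a"] unfolding h_def by linarith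
  qed
  have "h a = 0"
  proof (rule ccontr)
    assume "h a \<noteq> 0"
    then obtain n :: nat where "real n * \<bar>h a\<bar> > C + \<bar>g 1\<bar>"
      using reals_Archimedean3[of "\<bar>h a\<bar>"] by auto
    moreover have "\<bar>h (of_nat n * a)\<bar> = real n * \<bar>h a\<bar>"
      by (simp add: hnat abs_mult)
    ultimately show False using hbd[of "of_nat n * a"] by simp
  qed
  then show ?thesis by (simp add: h_def)
qed

text \<open>Only inequalities are assumed, because these are what infima and suprema of quadratic
  forms satisfy directly. Both improve to equalities: homogeneity by applying it to
  \<open>1 / c\<close> and \<open>c x\<close>, the parallelogram law by applying it to
  \<open>x + y\<close> and \<open>x - y\<close>.\<close>

lemma form_of_quadratic:
  fixes q :: "'x::complex_vector \<Rightarrow> real"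
  assumes nonneg: "\<And>x. 0 \<le> q x"
    and hom_le: "\<And>c x. q (c *\<^sub>C x) \<le> (cmod c)\<^sup>2 * q x"
    and par_le: "\<And>x y. q (x + y) + q (x - y) \<le> 2 * q x + 2 * q y"
  shows "\<exists>t. is_form t \<and> (\<forall>x. quad t x = q x)"
proof -
  have hom: "q (c *\<^sub>C x) = (cmod c)\<^sup>2 * q x" for c x
  proof (cases "c = 0")
    case True
    then show ?thesis using hom_le[of 0 x] nonneg[of "0 *\<^sub>C x"] by simp
  next
    case False
    then have "q x \<le> (cmod (1 / c))\<^sup>2 * q (c *\<^sub>C x)"
      using hom_le[of "1 / c" "c *\<^sub>C x"] by (simp add: scaleC_scaleC scaleC_one)
    then have "(cmod c)\<^sup>2 * q x \<le> q (c *\<^sub>C x)"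
      using False by (simp add: norm_divide power_divide field_simps)
    then show ?thesis using hom_le[of c x] by simp
  qed
  have hom_R: "q (r *\<^sub>R x) = r\<^sup>2 * q x" for r x
    using hom[of "of_real r" x] by (simp add: scaleC_of_real)
  have two: "x + y + (x - y) = 2 *\<^sub>R x" "x + y - (x - y) = 2 *\<^sub>R y" for x y :: 'x
    by (simp_all add: scaleR_2)
  have par: "q (x + y) + q (x - y) = 2 * q x + 2 * q y" for x y
    using par_le[of x y] par_le[of "x + y" "x - y"] unfolding two hom_R by simp
  have q0: "q 0 = 0" using hom_R[of 0 0] by simp
  have qi: "q (\<i> *\<^sub>C x) = q x" for x using hom[of \<i> x] by simp
  have qm: "q (- x) = q x" for x using hom[of "-1" x] by (simp add: scaleC_minus_one)
  have qm': "q (x - y) = q (y - x)" for x y using qm[of "x - y"] by simp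
  \<comment> \<open>The candidate for the real part of the form.\<close>
  define B where "B x y = (q (x + y) - q (x - y)) / 4" for x y
  have sym: "B x y = B y x" for x y
    unfolding B_def qm'[of x y] by (simp add: add.commute)
  \<comment> \<open>Since \<open>x\<close> and \<open>y\<close> are \<open>?m + ?d\<close> and
    \<open>?m - ?d\<close>, the parallelogram law is applied around \<open>?m + z\<close> and around
    \<open>?m - z\<close>; the terms \<open>q ?d\<close> cancel in the difference. Taking
    \<open>x + y\<close> and 0 as the two vectors then turns this midpoint rule into
    additivity.\<close>
  have half: "B x z + B y z = 2 * B ((1/2) *\<^sub>R (x + y)) z" for x y z
  proof -
    let ?m = "(1/2) *\<^sub>R (x + y)" and ?d = "(1/2) *\<^sub>R (x - y)"
    have e: "?m + ?d = x" "?m - ?d = y"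
      by (simp_all add: algebra_simps flip: scaleR_left.add)
    have "(?m + z) + ?d = x + z" "(?m + z) - ?d = y + z" "(?m - z) + ?d = x - z" "(?m - z) - ?d = y - z"
      using e by (simp_all add: algebra_simps)
    then have "q (x + z) + q (y + z) = 2 * q (?m + z) + 2 * q ?d"
      "q (x - z) + q (y - z) = 2 * q (?m - z) + 2 * q ?d"
      using par[of "?m + z" ?d] par[of "?m - z" ?d] by (simp_all only:)
    then show ?thesis unfolding B_def by (simp add: field_simps)
  qed
  have B0: "B 0 z = 0" for z by (simp add: B_def qm)
  have add: "B (x + y) z = B x z + B y z" for x y z
    using half[of x z y] half[of "x + y" z 0] by (simp add: B0)
  have q_le: "q (x + y) \<le> 2 * q x + 2 * q y" "q (x - y) \<le> 2 * q x + 2 * q y" for x y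
    using par[of x y] nonneg[of "x + y"] nonneg[of "x - y"] by linarith+
  \<comment> \<open>On \<open>\<bar>a\<bar> \<le> 1\<close> the additive function
    \<open>B (a x) z\<close> of \<open>a\<close> is bounded by \<open>q x + q z\<close>, so it is
    linear in \<open>a\<close>.\<close>
  have scale: "B (r *\<^sub>R x) z = r * B x z" for r x z
  proof -
    have "\<bar>B (a *\<^sub>R x) z\<bar> \<le> q x + q z" if "\<bar>a\<bar> \<le> 1" for a
    proof -
      have "a\<^sup>2 * q x \<le> 1 * q x"
        using that nonneg by (intro mult_right_mono) (simp_all add: abs_square_le_1)
      then show ?thesis
        using q_le[of "a *\<^sub>R x" z] nonneg[of "a *\<^sub>R x + z"] nonneg[of "a *\<^sub>R x - z"] nonneg[of x]
          nonneg[of z]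
        unfolding B_def hom_R by (simp add: abs_le_iff)
    qed
    then show ?thesis
      using additive_bounded_linear[of "\<lambda>r. B (r *\<^sub>R x) z" "q x + q z" r]
      by (simp add: scaleR_left_distrib add)
  qed
  have Bi: "B (\<i> *\<^sub>C x) y = - B x (\<i> *\<^sub>C y)" for x y
  proof -
    have "q (\<i> *\<^sub>C x + y) = q (x - \<i> *\<^sub>C y)" "q (\<i> *\<^sub>C x - y) = q (x + \<i> *\<^sub>C y)"
      using qi[of "x - \<i> *\<^sub>C y"] qi[of "x + \<i> *\<^sub>C y"]
      by (simp_all add: scaleC_diff_right scaleC_add_right scaleC_scaleC scaleC_minus_one)
    then show ?thesis by (simp add: B_def diff_divide_distrib)
  qed
  have Bii: "B (\<i> *\<^sub>C x) (\<i> *\<^sub>C y) = B x y" for x y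
    using Bi[of x "\<i> *\<^sub>C y"] sym
    by (metis add.inverse_inverse Bi scaleC_scaleC i_squared scaleC_minus_one scale minus_mult_minus
        mult_minus1 scaleR_minus1_left)
  \<comment> \<open>The imaginary part is forced: antilinearity in the second argument gives
    \<open>Im (t x y) = Re (t x (\<i> y))\<close>.\<close>
  define t where "t x y = Complex (B x y) (B x (\<i> *\<^sub>C y))" for x y
  have t_add: "t (x + y) z = t x z + t y z" for x y z
    by (simp add: t_def add complex_eq_iff)
  have t_scale: "t (c *\<^sub>C x) z = c * t x z" for c x z
  proof -
    have "c *\<^sub>C x = Re c *\<^sub>R x + Im c *\<^sub>R (\<i> *\<^sub>C x)"
      unfolding scaleC_of_real[symmetric] scaleC_scaleC
      by (metis complex_eq mult.commute scaleC_add_left)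
    then show ?thesis
      by (simp add: t_def add scale complex_eq_iff Bi[of x z] Bii)
  qed
  have t_herm: "t y x = cnj (t x y)" for x y
    using Bi[of y x] by (simp add: t_def complex_eq_iff sym[of y] sym[of _ x])
  have t_diag: "t x x = of_real (q x)" for x
  proof -
    have "B x (\<i> *\<^sub>C x) = 0"
      using t_herm[of x x] by (simp add: t_def complex_eq_iff)
    moreover have "B x x = q x"
      using hom_R[of 2 x] by (simp add: B_def q0 scaleR_2)
    ultimately show ?thesis by (simp add: t_def complex_eq_iff)
  qed
  have "is_form t"
    unfolding is_form_def clinear_def antilinear_def
  proof (intro conjI allI)
    fix x y z c
    show "t (x + y) z = t x z + t y z" by (rule t_add)
    show "t (c *\<^sub>C x) z = c *\<^sub>C t x z" by (simp add: t_scale scaleC_complex_def)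
    show "t z (x + y) = t z x + t z y"
      unfolding t_herm[of z] by (simp add: t_add)
    show "t z (c *\<^sub>C x) = cnj c *\<^sub>C t z x"
      unfolding t_herm[of z] by (simp add: t_scale scaleC_complex_def)
    show "t x x \<in> \<real>\<^sub>\<ge>\<^sub>0" by (simp add: t_diag nonneg)
  qed
  moreover have "\<forall>x. quad t x = q x" by (simp add: quad_def t_diag)
  ultimately show ?thesis by blast
qed


section \<open>Parallel sums and the part of a form relative to another\<close>

lemma bdd_below_parallel:
  "is_form t \<Longrightarrow> is_form w \<Longrightarrow> bdd_below (range (\<lambda>y. quad t (x - y) + quad w y))"
  by (rule bdd_belowI[of _ 0]) (auto simp: quad_nonneg)

text \<open>The definite description is justified by \<open>form_of_quadratic\<close>. A
  decomposition of \<open>x\<close> is scaled to one of \<open>c x\<close>, and decompositions of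
  \<open>x\<close> and \<open>x'\<close> are added and subtracted to give ones of
  \<open>x + x'\<close> and \<open>x - x'\<close>.\<close>

lemma parallel_sum_props:
  assumes t: "is_form t" and w: "is_form w"
  shows form_parallel_sum: "is_form (parallel_sum t w)"
    and quad_parallel_sum: "quad (parallel_sum t w) x = (INF y. quad t (x - y) + quad w y)"
proof -
  define q where "q x = (INF y. quad t (x - y) + quad w y)" for x
  have q_le: "q x \<le> quad t (x - y) + quad w y" for x y
    unfolding q_def by (rule cINF_lower[OF bdd_below_parallel[OF t w]]) simp
  have q_greatest: "a \<le> q x" if "\<And>y. a \<le> quad t (x - y) + quad w y" for a x
    unfolding q_def by (rule cINF_greatest) (use that in auto)
  have nonneg: "0 \<le> q x" for x
    by (rule q_greatest) (simp add: quad_nonneg t w)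
  have hom: "q (c *\<^sub>C x) \<le> (cmod c)\<^sup>2 * q x" for c x
  proof (cases "c = 0")
    case True
    have "q (c *\<^sub>C x) \<le> quad t (c *\<^sub>C x - c *\<^sub>C x) + quad w (c *\<^sub>C x)" by (rule q_le)
    then show ?thesis using True quad_scaleC[OF w, of 0 x] quad_scaleR[OF t, of 0 x] by simp
  next
    case False
    have "q (c *\<^sub>C x) / (cmod c)\<^sup>2 \<le> q x"
    proof (rule q_greatest)
      fix y
      have "q (c *\<^sub>C x) \<le> quad t (c *\<^sub>C x - c *\<^sub>C y) + quad w (c *\<^sub>C y)" by (rule q_le)
      also have "\<dots> = (quad t (x - y) + quad w y) * (cmod c)\<^sup>2"
        by (simp add: quad_scaleC t w algebra_simps flip: scaleC_diff_right)
      finally show "q (c *\<^sub>C x) / (cmod c)\<^sup>2 \<le> quad t (x - y) + quad w y"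
        using False by (simp add: divide_le_eq)
    qed
    then show ?thesis using False by (simp add: divide_le_eq mult.commute)
  qed
  have par: "q (x + x') + q (x - x') \<le> 2 * q x + 2 * q x'" for x x'
  proof -
    have 1: "q (x + x') + q (x - x') \<le> 2 * (quad t (x - y) + quad w y)
        + 2 * (quad t (x' - y') + quad w y')" for y y'
    proof -
      have e: "x + x' - (y + y') = (x - y) + (x' - y')" "x - x' - (y - y') = (x - y) - (x' - y')"
        by simp_all
      have "q (x + x') + q (x - x')
          \<le> (quad t ((x - y) + (x' - y')) + quad t ((x - y) - (x' - y')))
            + (quad w (y + y') + quad w (y - y'))"
        using add_mono[OF q_le[of "x + x'" "y + y'"] q_le[of "x - x'" "y - y'"]]
        unfolding e by (simp only: ac_simps)
      then show ?thesis
        unfolding quad_parallelogram[OF t] quad_parallelogram[OF w] by simp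
    qed
    \<comment> \<open>The infimum is taken over \<open>y'\<close> first, with \<open>y\<close>
      fixed, and then over \<open>y\<close>.\<close>
    have "(q (x + x') + q (x - x') - 2 * (quad t (x - y) + quad w y)) / 2 \<le> q x'" for y
      by (rule q_greatest) (use 1[of y] in \<open>simp add: field_simps\<close>)
    then have "(q (x + x') + q (x - x') - 2 * q x') / 2 \<le> q x"
      by (intro q_greatest) (simp add: field_simps)
    then show ?thesis by simp
  qed
  obtain p where p: "is_form p" "\<forall>x. quad p x = q x"
    using form_of_quadratic[of q] nonneg hom par by blast
  have "parallel_sum t w = p"
    unfolding parallel_sum_def
    using p by (intro the_equality) (auto simp: q_def intro!: form_eqI)
  then show "is_form (parallel_sum t w)"
    "quad (parallel_sum t w) x = (INF y. quad t (x - y) + quad w y)"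
    using p by (simp_all add: q_def)
qed

lemma parallel_sum_le:
  assumes "is_form t" "is_form w"
  shows "quad (parallel_sum t w) x \<le> quad t (x - y) + quad w y"
  unfolding quad_parallel_sum[OF assms]
  by (rule cINF_lower[OF bdd_below_parallel[OF assms]]) simp

lemma parallel_sum_greatest:
  assumes "is_form t" "is_form w" "\<And>y. a \<le> quad t (x - y) + quad w y"
  shows "a \<le> quad (parallel_sum t w) x"
  unfolding quad_parallel_sum[OF assms(1,2)] by (rule cINF_greatest) (use assms in auto)

lemma quad_zero: "is_form t \<Longrightarrow> quad t 0 = 0"
  using quad_scaleR[of t 0 0] by simp

lemma parallel_sum_le_left:
  "is_form t \<Longrightarrow> is_form w \<Longrightarrow> quad (parallel_sum t w) x \<le> quad t x"
  using parallel_sum_le[of t w x 0] by (simp add: quad_zero)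

lemma parallel_sum_le_right:
  "is_form t \<Longrightarrow> is_form w \<Longrightarrow> quad (parallel_sum t w) x \<le> quad w x"
  using parallel_sum_le[of t w x x] by (simp add: quad_zero)

lemma parallel_sum_mono_nat:
  assumes t: "is_form t" and w: "is_form w" and "m \<le> n"
  shows "quad (parallel_sum t (\<lambda>u v. of_nat m * w u v)) x
    \<le> quad (parallel_sum t (\<lambda>u v. of_nat n * w u v)) x"
proof (rule parallel_sum_greatest[OF t form_of_nat_scale[OF w]])
  fix y
  have "real m * quad w y \<le> real n * quad w y"
    using \<open>m \<le> n\<close> quad_nonneg[OF w] by (intro mult_right_mono) simp_all
  then show "quad (parallel_sum t (\<lambda>u v. of_nat m * w u v)) x
      \<le> quad t (x - y) + quad (\<lambda>u v. of_nat n * w u v) y"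
    using parallel_sum_le[OF t form_of_nat_scale[OF w], of m x y] by simp
qed

section \<open>The part of a form relative to another as an increasing limit\<close>

lemma bdd_above_form_D:
  assumes "is_form t" "is_form w"
  shows "bdd_above (range (\<lambda>n::nat. quad (parallel_sum t (\<lambda>u v. of_nat n * w u v)) x))"
  using assms by (intro bdd_aboveI[of _ "quad t x"]) (auto intro!: parallel_sum_le_left form_of_nat_scale)

lemma form_D_props:
  assumes t: "is_form t" and w: "is_form w"
  shows form_form_D: "is_form (form_D w t)"
    and quad_form_D: "quad (form_D w t) x
      = (SUP n::nat. quad (parallel_sum t (\<lambda>u v. of_nat n * w u v)) x)"
proof -
  define p where "p n = parallel_sum t (\<lambda>u v. of_nat n * w u v)" for n :: nat
  define q where "q x = (SUP n. quad (p n) x)" for x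
  have p: "is_form (p n)" for n
    unfolding p_def by (intro form_parallel_sum t form_of_nat_scale w)
  have mono: "quad (p m) x \<le> quad (p n) x" if "m \<le> n" for m n x
    unfolding p_def by (rule parallel_sum_mono_nat[OF t w that])
  have q_upper: "quad (p n) x \<le> q x" for n x
    unfolding q_def p_def by (rule cSUP_upper[OF _ bdd_above_form_D[OF t w]]) simp
  have q_least: "q x \<le> a" if "\<And>n. quad (p n) x \<le> a" for a x
    unfolding q_def by (rule cSUP_least) (use that in auto)
  have nonneg: "0 \<le> q x" for x
    using q_upper[of 0 x] quad_nonneg[OF p, of 0 x] by linarith
  have hom: "q (c *\<^sub>C x) \<le> (cmod c)\<^sup>2 * q x" for c x
    by (rule q_least) (simp add: quad_scaleC[OF p] q_upper mult_left_mono)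
  have par: "q (x + y) + q (x - y) \<le> 2 * q x + 2 * q y" for x y
  proof -
    \<comment> \<open>The two suprema on the left may be approached along different indices;
      monotonicity raises both to \<open>max m n\<close>, where the parallelogram law holds.\<close>
    have 1: "quad (p m) (x + y) + quad (p n) (x - y) \<le> 2 * q x + 2 * q y" for m n
      using mono[of m "max m n" "x + y"] mono[of n "max m n" "x - y"]
        quad_parallelogram[OF p, of "max m n" x y] q_upper[of "max m n" x] q_upper[of "max m n" y]
      by simp
    have "quad (p m) (x + y) \<le> 2 * q x + 2 * q y - q (x - y)" for m
    proof -
      have "q (x - y) \<le> 2 * q x + 2 * q y - quad (p m) (x + y)"
        by (rule q_least) (use 1[of m] in \<open>simp add: algebra_simps\<close>)
      then show ?thesis by simp
    qed
    then have "q (x + y) \<le> 2 * q x + 2 * q y - q (x - y)" by (rule q_least)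
    then show ?thesis by simp
  qed
  obtain d where d: "is_form d" "\<forall>x. quad d x = q x"
    using form_of_quadratic[of q] nonneg hom par by blast
  have "form_D w t = d"
    unfolding form_D_def
    using d by (intro the_equality) (auto simp: q_def p_def intro!: form_eqI)
  then show "is_form (form_D w t)"
    "quad (form_D w t) x = (SUP n::nat. quad (parallel_sum t (\<lambda>u v. of_nat n * w u v)) x)"
    using d by (simp_all add: q_def p_def)
qed

lemma parallel_sum_le_form_D:
  assumes "is_form t" "is_form w"
  shows "quad (parallel_sum t (\<lambda>u v. of_nat n * w u v)) x \<le> quad (form_D w t) x"
  unfolding quad_form_D[OF assms] by (rule cSUP_upper[OF _ bdd_above_form_D[OF assms]]) simp

lemma form_D_least:
  assumes "is_form t" "is_form w"
    and "\<And>n::nat. quad (parallel_sum t (\<lambda>u v. of_nat n * w u v)) x \<le> a"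
  shows "quad (form_D w t) x \<le> a"
  unfolding quad_form_D[OF assms(1,2)] by (rule cSUP_least) (use assms in auto)

lemma form_D_le: "is_form t \<Longrightarrow> is_form w \<Longrightarrow> form_le (form_D w t) t"
  unfolding form_le_def by (intro allI form_D_least parallel_sum_le_left form_of_nat_scale)

text \<open>From \<open>p \<le> t\<close> and \<open>(n / c) p \<le> n w\<close>, the parallel sum
  \<open>t : n w\<close> dominates \<open>(n / c) / (1 + n / c)\<close> times \<open>p\<close> by
  \<open>quad_split_lower\<close>, and this factor tends to 1.\<close>

lemma form_le_form_D:
  assumes p: "is_form p" and t: "is_form t" and w: "is_form w"
    and pt: "form_le p t" and c: "0 < c" and pw: "\<And>x. quad p x \<le> c * quad w x"
  shows "form_le p (form_D w t)"
  unfolding form_le_def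
proof
  fix x
  let ?D = "quad (form_D w t) x"
  \<comment> \<open>The same estimate with denominators cleared: the right side does not depend on
    \<open>n\<close>, so the Archimedean property excludes a positive difference on the
    left.\<close>
  have bound: "real n * (quad p x - ?D) \<le> c * ?D" for n
  proof -
    have "real n / c / (1 + real n / c) * quad p x
        \<le> quad (parallel_sum t (\<lambda>u v. of_nat n * w u v)) x"
    proof (rule parallel_sum_greatest[OF t form_of_nat_scale[OF w]])
      fix y
      have "real n / c * quad p y \<le> real n / c * (c * quad w y)"
        using c pw by (intro mult_left_mono) simp_all
      moreover have "quad p (x - y) \<le> quad t (x - y)"
        using pt by (simp add: form_le_def)
      moreover have "real n / c / (1 + real n / c) * quad p x
          \<le> quad p (x - y) + real n / c * quad p y"
        using c by (intro quad_split_lower p) simp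
      ultimately show "real n / c / (1 + real n / c) * quad p x
          \<le> quad t (x - y) + quad (\<lambda>u v. of_nat n * w u v) y"
        using c by simp
    qed
    also have "\<dots> \<le> ?D" by (rule parallel_sum_le_form_D[OF t w])
    also have "real n / c / (1 + real n / c) = real n / (c + real n)"
      using c by (simp add: field_simps)
    finally have "real n * quad p x \<le> ?D * (c + real n)"
      using c by (simp add: divide_le_eq split: if_splits)
    then show ?thesis by (simp add: algebra_simps)
  qed
  show "quad p x \<le> ?D"
  proof (rule ccontr)
    assume "\<not> quad p x \<le> ?D"
    then have "0 < quad p x - ?D" by simp
    from reals_Archimedean3[OF this] obtain n where "c * ?D < real n * (quad p x - ?D)" by blast
    with bound[of n] show False by simp
  qed
qed

text \<open>Divided by \<open>n\<close>, the form \<open>t : n w\<close> becomes a common minorant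
  of \<open>w\<close> and \<open>t\<close>, hence zero.\<close>

lemma parallel_sum_singular:
  assumes t: "is_form t" and w: "is_form w" and sing: "form_singular w t" and n: "0 < n"
  shows "quad (parallel_sum t (\<lambda>u v. of_nat n * w u v)) x = 0"
proof -
  let ?s = "parallel_sum t (\<lambda>u v. of_nat n * w u v)"
  let ?r = "\<lambda>u v. of_real (1 / real n) * ?s u v"
  have s: "is_form ?s" by (intro form_parallel_sum t form_of_nat_scale w)
  have "is_form ?r" by (intro form_scale s) simp
  moreover have "form_le ?r w"
    using n parallel_sum_le_right[OF t form_of_nat_scale[OF w], of n]
    unfolding form_le_def quad_scale by (simp add: field_simps)
  moreover have "form_le ?r t"
    unfolding form_le_def quad_scale
  proof
    fix x
    have "1 / real n * quad ?s x \<le> 1 * quad ?s x"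
      using n quad_nonneg[OF s, of x] by (intro mult_right_mono) simp_all
    then show "1 / real n * quad ?s x \<le> quad t x"
      using parallel_sum_le_left[OF t form_of_nat_scale[OF w], of n x] by simp
  qed
  ultimately have "?r = (\<lambda>x y. 0)"
    using sing unfolding form_singular_def by blast
  then have "quad ?r x = 0" by (simp add: quad_def)
  then show ?thesis using n unfolding quad_scale by simp
qed

text \<open>Singularity makes \<open>u : n w\<close> vanish, so for any \<open>n\<close> some \<open>y\<close> makes both
  \<open>u[x - y]\<close> and \<open>w[y]\<close> small, and then \<open>w[x - y]\<close> is close to \<open>w[x]\<close>.\<close>

lemma form_D_le_of_singular:
  assumes w: "is_form w" and t: "is_form t" and wt: "form_le w t"
    and sing: "form_singular w (\<lambda>x y. t x y - w x y)"
  shows "form_le (form_D w t) w"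
  unfolding form_le_def
proof (intro allI form_D_least t w)
  fix x and m :: nat
  let ?u = "\<lambda>x y. t x y - w x y"
  \<comment> \<open>A positive index gives \<open>quad w y \<le> n * quad w y\<close> and admits
    \<open>parallel_sum_singular\<close>; monotonicity in the index returns to \<open>m\<close> at
    the end.\<close>
  define n where "n = Suc m"
  let ?P = "quad (parallel_sum t (\<lambda>u v. of_nat n * w u v)) x"
  have u: "is_form ?u" by (rule form_diff[OF w t wt])
  have "?P \<le> quad w x"
  proof (rule field_le_epsilon)
    fix e :: real assume e: "0 < e"
    \<comment> \<open>The choices make \<open>d * quad w x \<le> e / 2\<close> and
      \<open>(2 + 1 / d) * \<epsilon> = e / 2\<close>. The summand 1 in the denominator covers
      \<open>quad w x = 0\<close>.\<close>
    define d where "d = e / (2 * (1 + quad w x))"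
    define \<epsilon> where "\<epsilon> = e / 2 / (2 + 1 / d)"
    have wx: "0 \<le> quad w x" by (rule quad_nonneg[OF w])
    have d: "0 < d" using e wx by (simp add: d_def)
    have "(INF y. quad ?u (x - y) + quad (\<lambda>u v. of_nat n * w u v) y) = 0"
      using parallel_sum_singular[OF u w sing, of n x]
      unfolding quad_parallel_sum[OF u form_of_nat_scale[OF w]] by (simp add: n_def)
    moreover have \<epsilon>: "0 < \<epsilon>"
      unfolding \<epsilon>_def using e d by (intro divide_pos_pos mult_pos_pos add_pos_pos) simp_all
    ultimately obtain y where y: "quad ?u (x - y) + real n * quad w y < \<epsilon>"
      using cINF_less_iff[OF _ bdd_below_parallel[OF u form_of_nat_scale[OF w]], of x n \<epsilon>] by auto
    have "1 * quad w y \<le> real n * quad w y"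
      by (intro mult_right_mono) (simp_all add: n_def quad_nonneg w)
    moreover have "0 \<le> quad ?u (x - y)" by (rule quad_nonneg[OF u])
    ultimately have wy: "quad w y \<le> \<epsilon>" using y by linarith
    \<comment> \<open>Here \<open>t = w + ?u\<close> is split at \<open>x - y\<close>, so that the
      bracket is the quantity below \<open>\<epsilon>\<close>.\<close>
    have "?P \<le> quad w (x - y) + (quad ?u (x - y) + real n * quad w y)"
      using parallel_sum_le[OF t form_of_nat_scale[OF w], of n x y] by simp
    also have "\<dots> \<le> (1 + d) * quad w x + (1 + 1 / d) * quad w y + \<epsilon>"
      using quad_diff_le[OF w d, of x y] y by linarith
    also have "\<dots> \<le> (1 + d) * quad w x + (1 + 1 / d) * \<epsilon> + \<epsilon>"
      using d wy by (intro add_mono mult_left_mono order_refl) simp_all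
    also have "\<dots> = quad w x + d * quad w x + (2 + 1 / d) * \<epsilon>"
      by (simp add: algebra_simps)
    also have "(2 + 1 / d) * \<epsilon> = e / 2"
    proof -
      have "0 < 2 + 1 / d" using d by (intro add_pos_pos) simp_all
      then show ?thesis
        using \<epsilon>_def by (metis less_irrefl mult.commute nonzero_eq_divide_eq)
    qed
    also have "d * quad w x \<le> e / 2"
      using e wx by (simp add: d_def field_simps)
    finally show "?P \<le> quad w x + e" by simp
  qed
  then show "quad (parallel_sum t (\<lambda>u v. of_nat m * w u v)) x \<le> quad w x"
    using parallel_sum_mono_nat[OF t w, of m n x] by (simp add: n_def)
qed

lemma form_le_antisym: "is_form s \<Longrightarrow> is_form t \<Longrightarrow> form_le s t \<Longrightarrow> form_le t s \<Longrightarrow> s = t"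
  by (rule form_eqI) (auto simp: form_le_def intro: antisym)

lemma form_singular_iff_form_D:
  assumes w: "is_form w" and t: "is_form t" and wt: "form_le w t"
  shows "form_singular w (\<lambda>x y. t x y - w x y) \<longleftrightarrow> form_D w t = w"
proof
  assume "form_singular w (\<lambda>x y. t x y - w x y)"
  then have "form_le (form_D w t) w" by (rule form_D_le_of_singular[OF w t wt])
  moreover have "form_le w (form_D w t)"
    by (rule form_le_form_D[where c = 1]) (use assms in auto)
  ultimately show "form_D w t = w"
    by (intro form_le_antisym form_form_D t w)
next
  assume D: "form_D w t = w"
  show "form_singular w (\<lambda>x y. t x y - w x y)"
    unfolding form_singular_def
  proof (intro allI impI)
    fix s :: "'a form"
    assume s: "is_form s" and sw: "form_le s w" and su: "form_le s (\<lambda>x y. t x y - w x y)"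
    \<comment> \<open>The form \<open>w + s\<close> is below \<open>t\<close> because
      \<open>s \<le> t - w\<close>, and below \<open>2 w\<close> because \<open>s \<le> w\<close>.
      With \<open>D\<close> it is below \<open>w\<close>, which leaves no room for
      \<open>s\<close>.\<close>
    have "form_le (\<lambda>x y. w x y + s x y) (form_D w t)"
    proof (rule form_le_form_D[where c = 2])
      show "form_le (\<lambda>x y. w x y + s x y) t"
        using su by (simp add: form_le_def algebra_simps)
      show "quad (\<lambda>x y. w x y + s x y) x \<le> 2 * quad w x" for x
        using sw by (simp add: form_le_def)
    qed (use w s t in \<open>simp_all add: form_add\<close>)
    then have "quad s x = 0" for x
      using quad_nonneg[OF s, of x] unfolding D form_le_def by (simp add: antisym)
    moreover have "is_form (\<lambda>x y :: 'a. 0)"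
      by (simp add: is_form_def clinear_def antilinear_def)
    ultimately show "s = (\<lambda>x y. 0)"
      using s by (intro form_eqI) (simp_all add: quad_def)
  qed
qed

section \<open>Forms associated with kernels\<close>

lemma cpairing_add_left: "cpairing (x + y) \<phi> = cpairing x \<phi> + cpairing y \<phi>"
  and cpairing_scaleC_left: "cpairing (c *\<^sub>C x) \<phi> = c * cpairing x \<phi>"
  and cpairing_scaleC_right: "cpairing x (c *\<^sub>C \<phi>) = cnj c * cpairing x \<phi>"
  using clinear_cpairing[of \<phi>] antilinear_cpairing[of x]
  by (simp_all add: clinear_def antilinear_def scaleC_complex_def)

lemma cpairing_zero_left [simp]: "cpairing 0 \<phi> = 0"
  and cpairing_zero_right [simp]: "cpairing x 0 = 0"
  using cpairing_scaleC_left[of 0 0 \<phi>] cpairing_scaleR_right[of x 0 0] by simp_all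

lemma cpairing_diff_right: "cpairing x (\<phi> - \<psi>) = cpairing x \<phi> - cpairing x \<psi>"
  using cpairing_add_right[of x "\<phi> - \<psi>" \<psi>] by simp

lemma cdual_eqI: "(\<And>x. cpairing x \<phi> = cpairing x \<psi>) \<Longrightarrow> \<phi> = \<psi>"
  by transfer (rule blinfun_eqI)

lemma norm_cpairing_le: "cmod (cpairing x \<phi>) \<le> norm \<phi> * norm x"
  by transfer (rule norm_blinfun)

lemma norm_cdual_bound:
  "0 \<le> b \<Longrightarrow> (\<And>x. cmod (cpairing x \<phi>) \<le> b * norm x) \<Longrightarrow> norm \<phi> \<le> b"
  by transfer (rule norm_blinfun_bound)

lemma cdual_of_functional:
  fixes F :: "'a::complex_normed_vector \<Rightarrow> complex"
  assumes F: "clinear F" and b: "\<And>x. cmod (F x) \<le> b * norm x"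
  shows "\<exists>\<phi>. \<forall>x. cpairing x \<phi> = F x"
proof -
  have "bounded_linear F"
    using F b unfolding clinear_def
    by (intro bounded_linear_intro[where K = b])
       (simp_all add: mult.commute scaleC_complex_def scaleR_conv_of_real flip: scaleC_of_real)
  then have "blinfun_apply (Blinfun F) = F" by (rule bounded_linear_Blinfun_apply)
  then show ?thesis
    using F by (intro exI[of _ "Abs_cdual (Blinfun F)"])
      (simp add: cpairing.rep_eq Abs_cdual_inverse)
qed

text \<open>The supports of \<open>f + g\<close> and \<open>c f\<close> can shrink through
  cancellation, so linearity is checked over one finite set containing all supports
  involved.\<close>

lemma kernel_form_superset:
  assumes "finite A" "finite B" "Poly_Mapping.keys f \<subseteq> A" "Poly_Mapping.keys g \<subseteq> B"
  shows "kernel_form K f g = (\<Sum>s\<in>B. \<Sum>t\<in>A.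
    cpairing (Poly_Mapping.lookup f t) (blinfun_apply (K s t) (Poly_Mapping.lookup g s)))"
  unfolding kernel_form_def
proof (rule sum.mono_neutral_cong_left[OF assms(2,4)])
  show "\<forall>s\<in>B - Poly_Mapping.keys g. (\<Sum>t\<in>A.
    cpairing (Poly_Mapping.lookup f t) (blinfun_apply (K s t) (Poly_Mapping.lookup g s))) = 0"
    by (simp add: in_keys_iff)
  show "(\<Sum>t\<in>Poly_Mapping.keys f.
      cpairing (Poly_Mapping.lookup f t) (blinfun_apply (K s t) (Poly_Mapping.lookup g s)))
    = (\<Sum>t\<in>A. cpairing (Poly_Mapping.lookup f t) (blinfun_apply (K s t) (Poly_Mapping.lookup g s)))"
    for s
    by (rule sum.mono_neutral_left[OF assms(1,3)]) (simp add: in_keys_iff)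
qed

lemma keys_scaleC: "Poly_Mapping.keys (c *\<^sub>C f) \<subseteq> Poly_Mapping.keys f"
  by (auto simp: in_keys_iff scaleC_poly_mapping.rep_eq)

lemma form_kernel_form:
  assumes K: "is_kernel K" shows "is_form (kernel_form K)"
proof -
  have lin: "blinfun_apply (K s t) (c *\<^sub>C x) = c *\<^sub>C blinfun_apply (K s t) x" for s t c x
    using K by (simp add: is_kernel_def clinear_def)
  have add: "kernel_form K (f + g) h = kernel_form K f h + kernel_form K g h"
    "kernel_form K h (f + g) = kernel_form K h f + kernel_form K h g" for f g h
  proof -
    let ?A = "Poly_Mapping.keys f \<union> Poly_Mapping.keys g \<union> Poly_Mapping.keys h"
    note * = kernel_form_superset[of ?A ?A]
    have sub: "Poly_Mapping.keys (f + g) \<subseteq> ?A" using keys_add[of f g] by blast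
    show "kernel_form K (f + g) h = kernel_form K f h + kernel_form K g h"
      using sub by (subst (1 2 3) *) (auto simp: lookup_add cpairing_add_left sum.distrib)
    show "kernel_form K h (f + g) = kernel_form K h f + kernel_form K h g"
      using sub by (subst (1 2 3) *) (auto simp: lookup_add cpairing_add_right blinfun.add_right sum.distrib)
  qed
  have scale: "kernel_form K (c *\<^sub>C f) h = c * kernel_form K f h"
    "kernel_form K h (c *\<^sub>C f) = cnj c * kernel_form K h f" for c f h
  proof -
    let ?A = "Poly_Mapping.keys f \<union> Poly_Mapping.keys h"
    note * = kernel_form_superset[of ?A ?A]
    have sub: "Poly_Mapping.keys (c *\<^sub>C f) \<subseteq> ?A" using keys_scaleC[of c f] by blast
    show "kernel_form K (c *\<^sub>C f) h = c * kernel_form K f h"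
      using sub by (subst (1 2) *)
        (auto simp: scaleC_poly_mapping.rep_eq cpairing_scaleC_left sum_distrib_left)
    show "kernel_form K h (c *\<^sub>C f) = cnj c * kernel_form K h f"
      using sub by (subst (1 2) *)
        (auto simp: scaleC_poly_mapping.rep_eq cpairing_scaleC_right lin sum_distrib_left)
  qed
  show ?thesis
    using K by (simp add: is_form_def clinear_def antilinear_def add scale scaleC_complex_def is_kernel_def)
qed

lemma kernel_form_single:
  "kernel_form K (Poly_Mapping.single t x) (Poly_Mapping.single s y)
    = cpairing x (blinfun_apply (K s t) y)"
  by (subst kernel_form_superset[of "{t}" "{s}"]) auto

text \<open>Functions supported at one point recover every operator \<open>K s t\<close>.\<close>

lemma kernel_form_inject:
  assumes "kernel_form K = kernel_form L" shows "K = L"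
  by (intro ext blinfun_eqI cdual_eqI)
     (metis assms kernel_form_single)

lemma scaleC_single: "c *\<^sub>C Poly_Mapping.single s x = Poly_Mapping.single s (c *\<^sub>C x)"
  by (rule poly_mapping_eqI) (simp add: scaleC_poly_mapping.rep_eq lookup_single when_def)

lemma sum_single_lookup:
  "(\<Sum>t\<in>Poly_Mapping.keys f. Poly_Mapping.single t (Poly_Mapping.lookup f t)) = f"
  by (rule poly_mapping_eqI) (simp add: lookup_sum lookup_single when_def in_keys_iff)

lemma form_sum_left: "is_form d \<Longrightarrow> d (\<Sum>i\<in>A. f i) z = (\<Sum>i\<in>A. d (f i) z)"
  and form_sum_right: "is_form d \<Longrightarrow> d z (\<Sum>i\<in>A. f i) = (\<Sum>i\<in>A. d z (f i))"
proof -
  assume d: "is_form d"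
  have 0: "d 0 z = 0" "d z 0 = 0"
    using form_scaleC_left[OF d, of 0 0] form_scaleC_right[OF d, of _ 0 0] by simp_all
  show "d (\<Sum>i\<in>A. f i) z = (\<Sum>i\<in>A. d (f i) z)"
    by (induction A rule: infinite_finite_induct) (simp_all add: 0 form_add_left d)
  show "d z (\<Sum>i\<in>A. f i) = (\<Sum>i\<in>A. d z (f i))"
    by (induction A rule: infinite_finite_induct) (simp_all add: 0 form_add_right d)
qed

text \<open>The operators are read off from the values on functions supported at one point;
  Cauchy--Schwarz and the domination by \<open>K\<close> make them bounded.\<close>

lemma kernel_of_form:
  fixes K :: "('s, 'e::complex_banach) opker"
  assumes K: "is_kernel K" and d: "is_form d" and le: "form_le d (kernel_form K)"
  shows "\<exists>M. is_kernel M \<and> kernel_form M = d"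
proof -
  let ?s = "Poly_Mapping.single :: 's \<Rightarrow> 'e \<Rightarrow> _"
  \<comment> \<open>The operator bound that Cauchy--Schwarz yields from the diagonal estimate
    \<open>diag\<close>.\<close>
  define C where "C s t = sqrt (norm (K t t)) * sqrt (norm (K s s))" for s t
  have diag: "quad d (?s t x) \<le> norm (K t t) * (norm x)\<^sup>2" for t x
  proof -
    have "quad d (?s t x) \<le> quad (kernel_form K) (?s t x)" using le by (simp add: form_le_def)
    also have "\<dots> \<le> cmod (cpairing x (blinfun_apply (K t t) x))"
      by (simp add: quad_def kernel_form_single complex_Re_le_cmod)
    also have "\<dots> \<le> norm (blinfun_apply (K t t) x) * norm x" by (rule norm_cpairing_le)
    also have "\<dots> \<le> norm (K t t) * norm x * norm x"
      by (intro mult_right_mono norm_blinfun) simp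
    finally show ?thesis by (simp add: power2_eq_square mult.assoc)
  qed
  have bound: "cmod (d (?s t x) (?s s y)) \<le> C s t * norm y * norm x" for s t x y
  proof (rule power2_le_imp_le)
    have "(cmod (d (?s t x) (?s s y)))\<^sup>2 \<le> quad d (?s t x) * quad d (?s s y)"
      by (rule cauchy_schwarz_form[OF d])
    also have "\<dots> \<le> (norm (K t t) * (norm x)\<^sup>2) * (norm (K s s) * (norm y)\<^sup>2)"
      by (intro mult_mono diag) (simp_all add: quad_nonneg d)
    finally show "(cmod (d (?s t x) (?s s y)))\<^sup>2 \<le> (C s t * norm y * norm x)\<^sup>2"
      by (simp add: C_def power_mult_distrib mult_ac)
  qed (simp add: C_def)
  have C: "0 \<le> C s t" for s t by (simp add: C_def)
  have "\<exists>\<phi>. \<forall>x. cpairing x \<phi> = d (?s t x) (?s s y)" for s t y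
    using bound
    by (intro cdual_of_functional[where b = "C s t * norm y"])
       (simp_all add: clinear_def single_add form_add_left d form_scaleC_left scaleC_complex_def
          flip: scaleC_single)
  then have "\<exists>\<phi>. \<forall>s t y x. cpairing x (\<phi> s t y) = d (?s t x) (?s s y)"
    by (intro choice allI)
  then obtain \<phi> where \<phi>: "cpairing x (\<phi> s t y) = d (?s t x) (?s s y)" for s t x y
    by blast
  \<comment> \<open>The conjugated scalar multiplication of the dual turns antilinearity of
    \<open>d\<close> in its second argument into complex linearity.\<close>
  have clin: "clinear (\<phi> s t)" for s t
    unfolding clinear_def
    by (intro conjI allI cdual_eqI)
       (simp_all add: \<phi> cpairing_add_right cpairing_scaleC_right single_add form_add_right d
          form_scaleC_right flip: scaleC_single)
  have "bounded_linear (\<phi> s t)" for s t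
  proof (rule bounded_linear_intro[where K = "C s t"])
    show "norm (\<phi> s t y) \<le> norm y * C s t" for y
      using bound C by (intro norm_cdual_bound) (simp_all add: \<phi> mult_ac)
  qed (use clin in \<open>simp_all add: clinear_def flip: scaleC_of_real\<close>)
  then have app: "blinfun_apply (Blinfun (\<phi> s t)) = \<phi> s t" for s t
    by (rule bounded_linear_Blinfun_apply)
  define M where "M s t = Blinfun (\<phi> s t)" for s t
  have M: "kernel_form M = d"
  proof (intro ext)
    fix f g
    have "kernel_form M f g = (\<Sum>s\<in>Poly_Mapping.keys g. \<Sum>t\<in>Poly_Mapping.keys f.
        d (?s t (Poly_Mapping.lookup f t)) (?s s (Poly_Mapping.lookup g s)))"
      by (simp add: kernel_form_def M_def app \<phi>)
    also have "\<dots> = d f g"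
      by (simp add: sum_single_lookup flip: form_sum_left[OF d] form_sum_right[OF d])
    finally show "kernel_form M f g = d f g" .
  qed
  moreover have "is_kernel M"
    using d clin unfolding is_kernel_def M by (simp add: M_def app is_form_def)
  ultimately show ?thesis by blast
qed

text \<open>As \<open>form_D\<close> stays below the form of \<open>K\<close>,
  \<open>kernel_of_form\<close> supplies a kernel for the definite description, and
  \<open>kernel_form_inject\<close> makes it the only one.\<close>

lemma kernel_D_eq_iff:
  assumes K: "is_kernel K" and L: "is_kernel L" and M: "is_kernel M"
  shows "kernel_D L K = M \<longleftrightarrow> form_D (kernel_form L) (kernel_form K) = kernel_form M"
proof -
  have "is_form (kernel_form K)" "is_form (kernel_form L)"
    using K L by (simp_all add: form_kernel_form)
  then obtain N where N: "is_kernel N" "kernel_form N = form_D (kernel_form L) (kernel_form K)"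
    using kernel_of_form[OF K form_form_D form_D_le] by blast
  then have "kernel_D L K = N"
    unfolding kernel_D_def by (intro the_equality) (auto intro: kernel_form_inject)
  then show ?thesis using N kernel_form_inject by metis
qed

section \<open>Arithmetic and order of kernels\<close>

lemma kernel_form_zero: "kernel_form 0 = (\<lambda>f g. 0)"
  by (intro ext) (simp add: kernel_form_def)

lemma kernel_form_diff: "kernel_form (K - L) = (\<lambda>f g. kernel_form K f g - kernel_form L f g)"
  by (intro ext) (simp add: kernel_form_def blinfun.diff_left cpairing_diff_right sum_subtractf)

lemma kernel_form_plus: "kernel_form (K + L) = (\<lambda>f g. kernel_form K f g + kernel_form L f g)"
  by (intro ext kernel_form_add)

lemma kernel_interval_zero_iff:
  "U \<in> kernel_interval 0 K \<longleftrightarrow> is_kernel U \<and> form_le (kernel_form U) (kernel_form K)"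
  using quad_nonneg[OF form_kernel_form, of U]
  by (auto simp: kernel_interval_def kernel_le_def kernel_form_zero form_le_def quad_def)

lemma is_kernel_add: "is_kernel K \<Longrightarrow> is_kernel L \<Longrightarrow> is_kernel (K + L)"
  by (simp add: is_kernel_def clinear_def kernel_form_add blinfun.add_left scaleC_add_right
      algebra_simps nonneg_Reals_add_I)

lemma is_kernel_diff:
  assumes "is_kernel K" "is_kernel L" "L \<prec>\<^sub>K K" shows "is_kernel (K - L)"
proof -
  have "is_form (kernel_form (K - L))"
    unfolding kernel_form_diff using assms
    by (intro form_diff form_kernel_form) (simp_all add: kernel_le_def)
  then show ?thesis
    using assms by (simp add: is_kernel_def is_form_def clinear_def blinfun.diff_left
        scaleC_diff_right)
qed

section \<open>Extreme points of the interval from 0 to \<open>K\<close>\<close>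

lemma extreme_point_if_form_D:
  fixes J K :: "('s, 'e::complex_banach) opker"
  assumes J: "is_kernel J" and K: "is_kernel K" and JK: "J \<prec>\<^sub>K K"
    and D: "form_D (kernel_form J) (kernel_form K) = kernel_form J"
  shows "J extreme_point_of (kernel_interval 0 K)"
proof -
  have J_in: "J \<in> kernel_interval 0 K"
    using J JK by (simp add: kernel_interval_zero_iff kernel_le_def)
  \<comment> \<open>Stated for arbitrary positive weights so that it serves both ends of the
    segment. Positivity of \<open>V\<close> gives \<open>a U \<le> J\<close>, so \<open>U\<close> is
    below \<open>K\<close> and below \<open>(1 / a) J\<close>, hence below the relative part, which
    is \<open>J\<close> by \<open>D\<close>.\<close>
  have le: "form_le (kernel_form U) (kernel_form J)"
    if U: "U \<in> kernel_interval 0 K" and V: "V \<in> kernel_interval 0 K"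
      and a: "0 < a" and b: "0 < b" and eq: "J = a *\<^sub>R U + b *\<^sub>R V" for U V a b
  proof -
    have fU: "is_form (kernel_form U)" and fV: "is_form (kernel_form V)"
      using U V by (auto simp: kernel_interval_zero_iff form_kernel_form)
    have "quad (kernel_form U) x \<le> 1 / a * quad (kernel_form J) x" for x
    proof -
      have "quad (kernel_form J) x = a * quad (kernel_form U) x + b * quad (kernel_form V) x"
        unfolding eq by (simp add: quad_def kernel_form_add kernel_form_scaleR)
      moreover have "0 \<le> b * quad (kernel_form V) x" using b quad_nonneg[OF fV] by simp
      ultimately show ?thesis using a by (simp add: field_simps)
    qed
    then have "form_le (kernel_form U) (form_D (kernel_form J) (kernel_form K))"
      using U a K J by (intro form_le_form_D[where c = "1 / a"])
        (auto simp: kernel_interval_zero_iff form_kernel_form)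
    then show ?thesis by (simp add: D)
  qed
  have "J \<notin> open_segment U V"
    if U: "U \<in> kernel_interval 0 K" and V: "V \<in> kernel_interval 0 K" for U V
  proof
    assume "J \<in> open_segment U V"
    then obtain u where uv: "U \<noteq> V" and u: "0 < u" "u < 1" and eq: "J = (1 - u) *\<^sub>R U + u *\<^sub>R V"
      by (auto simp: in_segment)
    have fU: "is_form (kernel_form U)" and fV: "is_form (kernel_form V)"
      using U V by (auto simp: kernel_interval_zero_iff form_kernel_form)
    have leU: "form_le (kernel_form U) (kernel_form J)"
      using le[OF U V _ _ eq] u by simp
    have leV: "form_le (kernel_form V) (kernel_form J)"
      using le[OF V U, of u "1 - u"] u eq by (simp add: add.commute)
    have "quad (kernel_form U) x = quad (kernel_form V) x" for x
    proof -
      let ?U = "quad (kernel_form U) x" and ?V = "quad (kernel_form V) x"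
      have q: "quad (kernel_form J) x = (1 - u) * ?U + u * ?V"
        unfolding eq by (simp add: quad_def kernel_form_add kernel_form_scaleR)
      \<comment> \<open>A proper convex combination can dominate both of its entries only if they
        agree.\<close>
      have "?U \<le> (1 - u) * ?U + u * ?V" "?V \<le> (1 - u) * ?U + u * ?V"
        using leU leV unfolding form_le_def q[symmetric] by blast+
      then have "u * ?U \<le> u * ?V" "(1 - u) * ?V \<le> (1 - u) * ?U"
        by (simp_all add: algebra_simps)
      then show ?thesis using u by simp
    qed
    then have "kernel_form U = kernel_form V" by (rule form_eqI[OF fU fV])
    then show False using uv kernel_form_inject by blast
  qed
  then show ?thesis using J_in by (auto simp: extreme_point_of_def)
qed

lemma singular_if_extreme_point:
  fixes J K :: "('s, 'e::complex_banach) opker"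
  assumes J: "is_kernel J" and K: "is_kernel K"
    and ext: "J extreme_point_of (kernel_interval 0 K)"
  shows "kernel_singular J (K - J)"
  unfolding kernel_singular_def form_singular_def
proof (intro allI impI)
  fix s
  assume s: "is_form s" and sJ: "form_le s (kernel_form J)"
    and sKJ: "form_le s (kernel_form (K - J))"
  obtain N where N: "is_kernel N" "kernel_form N = s"
    using kernel_of_form[OF J s sJ] by blast
  have "J + N \<in> kernel_interval 0 K"
    using J N sKJ
    by (simp add: kernel_interval_zero_iff is_kernel_add kernel_form_plus kernel_form_diff
        form_le_def algebra_simps)
  moreover have "J - N \<in> kernel_interval 0 K"
  proof -
    have "is_kernel (J - N)" using J N sJ by (intro is_kernel_diff) (simp_all add: kernel_le_def)
    \<comment> \<open>An extreme point belongs to the interval, which provides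
      \<open>J \<le> K\<close> here.\<close>
    moreover have "quad (kernel_form J) x - quad s x \<le> quad (kernel_form K) x" for x
      using ext quad_nonneg[OF s, of x]
      by (auto simp: extreme_point_of_def kernel_interval_zero_iff form_le_def intro: order_trans[rotated])
    ultimately show ?thesis
      using N by (simp add: kernel_interval_zero_iff kernel_form_diff form_le_def)
  qed
  ultimately have "J \<notin> open_segment (J + N) (J - N)"
    using ext unfolding extreme_point_of_def by blast
  moreover have "J = (1 - 1/2) *\<^sub>R (J + N) + (1/2) *\<^sub>R (J - N)"
    by (simp add: algebra_simps flip: scaleR_left.add)
  \<comment> \<open>\<open>J\<close> is the midpoint of the two kernels, so it can avoid their open
    segment only if the endpoints coincide.\<close>
  ultimately have "J + N = J - N"
    unfolding in_segment by (metis (full_types) field_sum_of_halves half_gt_zero_iff less_add_same_cancel1 zero_less_one)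
  then have "2 *\<^sub>R N = 0" by (simp add: scaleR_2 eq_diff_eq)
  then have "N = 0" by simp
  then show "s = (\<lambda>x y. 0)" using N by (simp add: kernel_form_zero)
qed

theorem corollary2p8:
  fixes J K :: "('s, 'e::complex_banach) opker"
  assumes "is_kernel J" and "is_kernel K" and "J \<prec>\<^sub>K K"
  shows "(kernel_singular J (K - J) \<longleftrightarrow> kernel_D J K = J) \<and>
         (kernel_D J K = J \<longleftrightarrow> J extreme_point_of (kernel_interval 0 K))"
proof -
  have "kernel_singular J (K - J) \<longleftrightarrow> kernel_D J K = J"
    unfolding kernel_singular_def kernel_form_diff kernel_D_eq_iff[OF assms(2,1,1)]
    using assms by (intro form_singular_iff_form_D form_kernel_form) (simp_all add: kernel_le_def)
  \<comment> \<open>Given the equivalence of (i) and (ii), the implications from (ii) to (iii) and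
    from (iii) to (i) close the cycle.\<close>
  moreover have "J extreme_point_of (kernel_interval 0 K)" if "kernel_D J K = J"
    using that assms by (intro extreme_point_if_form_D) (simp_all add: kernel_D_eq_iff)
  moreover have "kernel_singular J (K - J)" if "J extreme_point_of (kernel_interval 0 K)"
    using that assms by (intro singular_if_extreme_point)
  ultimately show ?thesis by blast
qed

end
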